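(* Assume that $\mathcal X=\{x\in\mathbb R^n\mid Cx\le d\}$ with $C\in\mathbb R^{m\times n}$, $d\in\mathbb R^m$, $\mathrm{rank}(C)=n$, and that for all $\delta\in\Delta$, $\mathcal X_\delta=\{x\in\mathbb R^n\mid A(\delta)x\le b(\delta)\}$, with $A:\Delta\to\mathbb R^{p\times n}$ and $b:\Delta\to\mathbb R^p$. Given any $K\in\mathbb N$ and $\delta_K\in\Delta^K$, Algorithm A (described in the context) returns a number $s^\star_K$ that is the cardinality of a support subsample for $\delta_K$ with respect to $\Omega_{\delta_K}$.
   Context: Setting. $\Delta\subseteq\mathbb R^\ell$; $\mathcal X\subseteq\mathbb R^n$ is a deterministic set, $F:\mathcal X\to\mathbb R^n$ a mapping, and for each $\delta\in\Delta$, $\mathcal X_\delta\subseteq\mathbb R^n$ is a constraint set. For a multisample $\delta_K=\{\delta^{(1)},\dots,\delta^{(K)}\}\in\Delta^K$, put $\mathcal K=\{1,\dots,K\}$ and $\mathcal X_{\delta_K}=\bigcap_{i\in\mathcal K}\mathcal X_{\delta^{(i)}}\cap\mathcal X$ (with $\mathcal X_{\delta_0}=\mathcal X$). For $\mathcal C\subseteq\mathcal X$, VI$(\mathcal C,F)$ is the problem of finding $x\in\mathcal C$ with $(y-x)^\top F(x)\ge0$ for all $y\in\mathcal C$. $\Omega_{\delta_K}$ is the set of all solutions of VI$(\mathcal X_{\delta_K},F)$, and $\Theta_K(\delta_K)=\Theta_K(\delta^{(1)},\dots,\delta^{(K)}):=\Omega_{\delta_K}$, with $\Theta_0:=\Omega_{\delta_0}$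 the solution set of VI$(\mathcal X,F)$. $\mathrm{bdry}$ denotes the topological boundary. Support subsample (with respect to $\Omega_{\delta_K}$). Given $\delta_K\in\Delta^K$, it is a tuple of unique elements $\{\delta^{(i_1)},\dots,\delta^{(i_q)}\}$, $i_1<\dots<i_q$, of $\delta_K$ such that $\Theta_q(\delta^{(i_1)},\dots,\delta^{(i_q)})=\Theta_K(\delta^{(1)},\dots,\delta^{(K)})$. Algorithm A. Initialization: set $s_K:=0$ and identify $\mathcal A_K:=\{k\in\mathcal K\mid\mathrm{bdry}(\mathcal X_{\delta^{(k)}})\cap\mathrm{bdry}(\mathcal X_{\delta_K})\ne\emptyset\}$. For each $i\in\mathcal A_K$: (S1) run a solution procedure $\Phi(\delta_{K,i})$ to solve VI$(\mathcal X_{\delta_K}\cap\mathrm{bdry}(\mathcal X_{\delta^{(i)}}),F)$, where $\Phi(\delta_{K,i})$ is the (set of) solution(s) returned, being empty exactly when no solution exists; (S2) if $\Phi(\delta_{K,i})\neq\emptyset$, set $s_K:=s_K+1$. The output $s_K^\star$ is the final value of $s_K$. Standing assumptions. (1) For every $K\in\mathbb N\cup\{0\}$ and every $\delta_K\in\Delta^K$, $\mathcal X_{\delta_K}$ is nonempty, compact and convex. (2) $F$ is continuous and pseudomonotone on $\mathcal X$, i.e. for all $x,y\in\mathcal X$, $(x-y)^\top F(y)\ge0$ implies $(x-y)^\top F(x)\ge0$. (3) For every $K\in\mathbb N$ and $\delta_K\in\Delta^K$, $\mathrm{aff}(\Omega_{\delta_K})=\mathrm{aff}(\Omega_{\delta_0})$,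 where $\mathrm{aff}$ denotes the affine hull. *)

theory Defs
  imports "HOL-Analysis.Analysis"
begin

definition VI_solutions ::
  "(real^'n) set \<Rightarrow> (real^'n \<Rightarrow> real^'n) \<Rightarrow> (real^'n) set" where
  "VI_solutions S F = {x \<in> S. \<forall>y\<in>S. 0 \<le> (y - x) \<bullet> F x}"

definition pseudomonotone_on ::
  "(real^'n) set \<Rightarrow> (real^'n \<Rightarrow> real^'n) \<Rightarrow> bool" where
  "pseudomonotone_on S F \<longleftrightarrow>
     (\<forall>x\<in>S. \<forall>y\<in>S. 0 \<le> (x - y) \<bullet> F y \<longrightarrow> 0 \<le> (x - y) \<bullet> F x)"

text \<open>A multisample in \<open>\<Delta>\<close> to the power \<open>K\<close> is a list of length \<open>K\<close>, possibly with
  repetitions; its entries, which are usually numbered from 1 to \<open>K\<close>, sit at the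
  positions from 0 to \<open>K - 1\<close>.\<close>

definition multisamples :: "'a set \<Rightarrow> nat \<Rightarrow> 'a list set" where
  "multisamples \<Delta> K = {ds. set ds \<subseteq> \<Delta> \<and> length ds = K}"

definition feasible ::
  "(real^'n) set \<Rightarrow> ('a \<Rightarrow> (real^'n) set) \<Rightarrow> 'a list \<Rightarrow> (real^'n) set" where
  "feasible X Xc ds = (\<Inter>i\<in>{..<length ds}. Xc (ds ! i)) \<inter> X"

definition Theta ::
  "(real^'n) set \<Rightarrow> ('a \<Rightarrow> (real^'n) set) \<Rightarrow> (real^'n \<Rightarrow> real^'n) \<Rightarrow> 'a list
     \<Rightarrow> (real^'n) set" where
  "Theta X Xc F ds = VI_solutions (feasible X Xc ds) F"

text \<open>A subsample is given by the strictly increasing list of the positions it occupies.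
  Entries of the multisample are thus told apart by their position: equal values
  drawn at different positions count as different entries. The cardinality of the
  subsample is the length of the list of positions.\<close>

definition support_subsample ::
  "(real^'n) set \<Rightarrow> ('a \<Rightarrow> (real^'n) set) \<Rightarrow> (real^'n \<Rightarrow> real^'n) \<Rightarrow> 'a list
     \<Rightarrow> nat list \<Rightarrow> bool" where
  "support_subsample X Xc F ds js \<longleftrightarrow>
     sorted_wrt (<) js \<and> set js \<subseteq> {..<length ds} \<and>
     Theta X Xc F (map (\<lambda>j. ds ! j) js) = Theta X Xc F ds"

definition active ::
  "(real^'n) set \<Rightarrow> ('a \<Rightarrow> (real^'n) set) \<Rightarrow> 'a list \<Rightarrow> nat set" where
  "active X Xc ds =
     {k \<in> {..<length ds}. frontier (Xc (ds ! k)) \<inter> frontier (feasible X Xc ds) \<noteq> {}}"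

text \<open>A solution procedure receives the multisample and the position of an active
  constraint. It may return any selection of solutions, as long as it returns at
  least one whenever there is one. The set on which the variational inequality is
  posed need not be convex here.\<close>

definition solution_procedure ::
  "'a set \<Rightarrow> (real^'n) set \<Rightarrow> ('a \<Rightarrow> (real^'n) set) \<Rightarrow> (real^'n \<Rightarrow> real^'n)
     \<Rightarrow> ('a list \<Rightarrow> nat \<Rightarrow> (real^'n) set) \<Rightarrow> bool" where
  "solution_procedure \<Delta> X Xc F \<Phi> \<longleftrightarrow>
     (\<forall>K. \<forall>ds \<in> multisamples \<Delta> K. \<forall>i \<in> active X Xc ds.
        let Sol = VI_solutions (feasible X Xc ds \<inter> frontier (Xc (ds ! i))) F
        in \<Phi> ds i \<subseteq> Sol \<and> (\<Phi> ds i = {} \<longleftrightarrow> Sol = {}))"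

definition algorithm_A ::
  "(real^'n) set \<Rightarrow> ('a \<Rightarrow> (real^'n) set) \<Rightarrow> ('a list \<Rightarrow> nat \<Rightarrow> (real^'n) set)
     \<Rightarrow> 'a list \<Rightarrow> nat" where
  "algorithm_A X Xc \<Phi> ds =
     fold (\<lambda>i s. if \<Phi> ds i \<noteq> {} then s + 1 else s)
       (sorted_list_of_set (active X Xc ds)) 0"

end

theory Submission imports Defs begin

text \<open>Let \<open>S\<close> be the set of positions counted by the algorithm, \<open>C\<close> the full feasible set and
  \<open>D\<close> the feasible set of the subsample \<open>S\<close>. A solution over \<open>C\<close> on the boundary of a constraint
  also solves the problem restricted to that boundary, so the solutions over \<open>C\<close> lie in the
  interior of every constraint outside \<open>S\<close>. They are thus local, hence by convexity global,
  solutions over \<open>D\<close>, and they form a subset of the solution set over \<open>D\<close> that is relatively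
  clopen. The latter set is convex by Minty's lemma, hence connected, and the former is nonempty
  by Brouwer's theorem, so the two are equal.\<close>

text \<open>A point solves the problem when it is a fixed point of the projected map that sends
  \<open>x\<close> to the point of \<open>S\<close> closest to \<open>x - F x\<close>. This map is a
  continuous self-map of \<open>S\<close>, so Brouwer's theorem applies.\<close>

lemma VI_solutions_nonempty:
  fixes F :: "real^'n \<Rightarrow> real^'n"
  assumes "compact S" "convex S" "S \<noteq> {}" "continuous_on S F"
  shows "VI_solutions S F \<noteq> {}"
proof -
  have "closed S" using assms(1) by (rule compact_imp_closed)
  define g where "g = (\<lambda>x. closest_point S (x - F x))"
  have "continuous_on S (\<lambda>x. x - F x)"
    using assms(4) by (intro continuous_intros)
  then have "continuous_on S g"
    unfolding g_def
    by (rule continuous_on_compose2[OF continuous_on_closest_point[OF assms(2) \<open>closed S\<close> assms(3)]])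
      auto
  moreover have "g \<in> S \<rightarrow> S"
    unfolding g_def using closest_point_in_set[OF \<open>closed S\<close> assms(3)] by auto
  ultimately obtain x where x: "x \<in> S" "g x = x"
    using brouwer[OF assms(1,2,3)] by metis
  \<comment> \<open>Since \<open>x\<close> is its own projection of \<open>x - F x\<close>, the
    residual of the projection is \<open>- F x\<close>, and it makes no acute angle with any
    direction \<open>y - x\<close> into \<open>S\<close>.\<close>
  have "0 \<le> (y - x) \<bullet> F x" if "y \<in> S" for y
    using closest_point_dot[OF assms(2) \<open>closed S\<close> that, of "x - F x"] x(2)
    unfolding g_def by (simp add: inner_commute)
  with x(1) show ?thesis unfolding VI_solutions_def by blast
qed

text \<open>Pseudomonotonicity gives one inclusion. For the other, the inequality is tested at
  points of the segment from \<open>x\<close> to \<open>y\<close>, which convexity keeps in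
  \<open>S\<close>, and these points then tend to \<open>x\<close>.\<close>

lemma VI_solutions_Minty:
  fixes F :: "real^'n \<Rightarrow> real^'n"
  assumes "convex S" "continuous_on S F" "pseudomonotone_on S F"
  shows "VI_solutions S F = {x \<in> S. \<forall>y\<in>S. 0 \<le> (y - x) \<bullet> F y}"
proof (intro equalityI subsetI)
  fix x assume "x \<in> VI_solutions S F"
  then show "x \<in> {x \<in> S. \<forall>y\<in>S. 0 \<le> (y - x) \<bullet> F y}"
    using assms(3) unfolding VI_solutions_def pseudomonotone_on_def by blast
next
  fix x assume "x \<in> {x \<in> S. \<forall>y\<in>S. 0 \<le> (y - x) \<bullet> F y}"
  then have x: "x \<in> S" and Minty: "\<And>y. y \<in> S \<Longrightarrow> 0 \<le> (y - x) \<bullet> F y" by auto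
  have "0 \<le> (y - x) \<bullet> F x" if y: "y \<in> S" for y
  proof -
    define p where "p = (\<lambda>t::real. x + t *\<^sub>R (y - x))"
    have p_in: "p t \<in> S" if "t \<in> {0..1}" for t
      using convexD_alt[OF assms(1) x y, of t] that
      unfolding p_def by (simp add: algebra_simps)
    have "continuous_on {0..1} (\<lambda>t. F (p t))"
      using p_in by (intro continuous_on_compose2[OF assms(2)])
        (auto simp: p_def intro!: continuous_intros)
    then have "((\<lambda>t. F (p t)) \<longlongrightarrow> F (p 0)) (at 0 within {0..1})"
      by (simp add: continuous_on_def)
    then have "((\<lambda>t. F (p t)) \<longlongrightarrow> F x) (at_right 0)"
      by (simp add: p_def at_within_Icc_at_right)
    then have lim: "((\<lambda>t. (y - x) \<bullet> F (p t)) \<longlongrightarrow> (y - x) \<bullet> F x) (at_right 0)"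
      by (intro tendsto_intros)
    \<comment> \<open>Here \<open>p t - x\<close> is \<open>t\<close> times \<open>y - x\<close>,
      and the positive factor \<open>t\<close> cancels.\<close>
    have "0 \<le> (y - x) \<bullet> F (p t)" if "t \<in> {0<..<1}" for t
      using Minty[OF p_in[of t]] that by (simp add: p_def zero_le_mult_iff)
    then have "\<forall>\<^sub>F t in at_right 0. 0 \<le> (y - x) \<bullet> F (p t)"
      using eventually_at_right_real[of 0 1] by (auto elim: eventually_mono)
    with lim show ?thesis
      by (intro tendsto_lowerbound) auto
  qed
  with x show "x \<in> VI_solutions S F" unfolding VI_solutions_def by blast
qed

text \<open>In Minty's form \<open>F\<close> is evaluated at the test point, so the condition on
  \<open>x\<close> is affine for each \<open>y\<close>, and the solution set is \<open>S\<close> cut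
  by closed half-spaces.\<close>

lemma closed_convex_VI_solutions:
  fixes F :: "real^'n \<Rightarrow> real^'n"
  assumes "closed S" "convex S" "continuous_on S F" "pseudomonotone_on S F"
  shows "closed (VI_solutions S F)" "convex (VI_solutions S F)"
proof -
  have "VI_solutions S F = S \<inter> (\<Inter>y\<in>S. {x. F y \<bullet> x \<le> F y \<bullet> y})"
    unfolding VI_solutions_Minty[OF assms(2-4)] by (auto simp: inner_diff_right inner_commute)
  then show "closed (VI_solutions S F)" "convex (VI_solutions S F)"
    using assms(1,2)
    by (auto intro!: closed_Int closed_INT closed_halfspace_le
        convex_Int convex_INT convex_halfspace_le)
qed

text \<open>A short step from \<open>x\<close> towards any \<open>y\<close> in \<open>D\<close>
  stays in \<open>D\<close> by convexity and in \<open>U\<close> by openness, hence in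
  \<open>C\<close>. The inequality known there is a positive multiple of the one wanted at
  \<open>y\<close>.\<close>

lemma VI_solution_local_to_global:
  fixes F :: "real^'n \<Rightarrow> real^'n"
  assumes "convex D" "open U" "x \<in> U" "D \<inter> U \<subseteq> C" "C \<subseteq> D" "x \<in> VI_solutions C F"
  shows "x \<in> VI_solutions D F"
proof -
  have x: "x \<in> D" and sol: "\<And>y. y \<in> C \<Longrightarrow> 0 \<le> (y - x) \<bullet> F x"
    using assms(5,6) unfolding VI_solutions_def by auto
  have "0 \<le> (y - x) \<bullet> F x" if y: "y \<in> D" for y
  proof -
    have "((\<lambda>t. x + t *\<^sub>R (y - x)) \<longlongrightarrow> x + 0 *\<^sub>R (y - x)) (at_right 0)"
      by (intro tendsto_intros)
    then have "\<forall>\<^sub>F t in at_right 0. x + t *\<^sub>R (y - x) \<in> U"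
      using assms(2,3) by (auto dest: topological_tendstoD)
    moreover have "\<forall>\<^sub>F t in at_right (0::real). t \<in> {0<..<1}"
      by (rule eventually_at_right_real) simp
    ultimately have "\<forall>\<^sub>F t in at_right (0::real). t \<in> {0<..<1} \<and> x + t *\<^sub>R (y - x) \<in> U"
      by (rule eventually_elim2) simp
    then obtain t :: real where t: "0 < t" "t < 1" "x + t *\<^sub>R (y - x) \<in> U"
      by (auto dest: eventually_happens)
    have "x + t *\<^sub>R (y - x) \<in> D"
      using convexD_alt[OF assms(1) x y, of t] t by (simp add: algebra_simps)
    with t assms(4) have "x + t *\<^sub>R (y - x) \<in> C" by blast
    from sol[OF this] t show ?thesis by (simp add: zero_le_mult_iff)
  qed
  with x show ?thesis unfolding VI_solutions_def by blast
qed

text \<open>The set \<open>U\<close> isolates the solutions over \<open>C\<close>: they are the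
  trace of \<open>U\<close> on the solution set over \<open>D\<close>, which gives relative
  openness. Minty's form over \<open>C\<close> gives closedness.\<close>

lemma VI_solutions_eq_of_clopen:
  fixes F :: "real^'n \<Rightarrow> real^'n"
  assumes C: "compact C" "convex C" "C \<noteq> {}" and D: "closed D" "convex D"
    and F: "continuous_on D F" "pseudomonotone_on D F"
    and U: "open U" "VI_solutions C F \<subseteq> U" "D \<inter> U \<subseteq> C" and "C \<subseteq> D"
  shows "VI_solutions D F = VI_solutions C F"
proof -
  have sub: "VI_solutions C F \<subseteq> VI_solutions D F"
    using VI_solution_local_to_global[OF D(2) U(1) _ U(3) \<open>C \<subseteq> D\<close>] U(2) by blast
  \<comment> \<open>A solution over \<open>D\<close> that lies in \<open>C\<close> faces fewer test
    points there, and a solution over \<open>D\<close> that lies in \<open>U\<close> does lie in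
    \<open>C\<close>.\<close>
  have "VI_solutions D F \<inter> C \<subseteq> VI_solutions C F" "VI_solutions D F \<subseteq> D"
    using \<open>C \<subseteq> D\<close> unfolding VI_solutions_def by auto
  then have eq: "VI_solutions C F = VI_solutions D F \<inter> U"
    using sub U by blast
  have "continuous_on C F" "pseudomonotone_on C F"
    using F \<open>C \<subseteq> D\<close> unfolding pseudomonotone_on_def by (auto intro: continuous_on_subset)
  then have "closed (VI_solutions C F)" "VI_solutions C F \<noteq> {}"
    using C closed_convex_VI_solutions(1) compact_imp_closed VI_solutions_nonempty by metis+
  moreover have "openin (top_of_set (VI_solutions D F)) (VI_solutions C F)"
    unfolding eq using U(1) by (rule openin_open_Int)
  moreover have "connected (VI_solutions D F)"
    using closed_convex_VI_solutions(2)[OF D F] by (rule convex_connected)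
  ultimately show ?thesis
    using sub closed_subset unfolding connected_clopen by metis
qed

lemma fold_count_eq_card:
  assumes "finite S"
  shows "fold (\<lambda>i s. if P i then s + 1 else s) (sorted_list_of_set S) (0::nat)
    = card {i \<in> S. P i}"
proof -
  have "fold (\<lambda>i s. if P i then s + 1 else s) xs n = n + length (filter P xs)" for xs and n :: nat
    by (induction xs arbitrary: n) auto
  then show ?thesis
    using assms distinct_card[of "filter P (sorted_list_of_set S)"] by (simp add: Int_def)
qed

theorem proposition2:
  fixes \<Delta> :: "(real^'l) set"
    and X :: "(real^'n) set"
    and Xc :: "real^'l \<Rightarrow> (real^'n) set"
    and F :: "real^'n \<Rightarrow> real^'n"
    and C :: "real^'n^'m" and d :: "real^'m"
    and A :: "real^'l \<Rightarrow> real^'n^'p" and b :: "real^'l \<Rightarrow> real^'p"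
    and \<Phi> :: "(real^'l) list \<Rightarrow> nat \<Rightarrow> (real^'n) set"
    and K :: nat and ds :: "(real^'l) list"
  assumes feasible_sets: "\<And>K ds. ds \<in> multisamples \<Delta> K \<Longrightarrow>
      feasible X Xc ds \<noteq> {} \<and> compact (feasible X Xc ds) \<and> convex (feasible X Xc ds)"
    and F_continuous: "continuous_on X F"
    and F_pseudomonotone: "pseudomonotone_on X F"
    and affine_hulls: "\<And>K ds. K \<ge> 1 \<Longrightarrow> ds \<in> multisamples \<Delta> K \<Longrightarrow>
      affine hull (Theta X Xc F ds) = affine hull (Theta X Xc F [])"
    and X_polyhedral: "X = {x. C *v x \<le> d}"
    and rank_C: "rank C = CARD('n)"
    and Xc_polyhedral: "\<And>\<delta>. \<delta> \<in> \<Delta> \<Longrightarrow> Xc \<delta> = {x. A \<delta> *v x \<le> b \<delta>}"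
    and procedure: "solution_procedure \<Delta> X Xc F \<Phi>"
    and K_pos: "K \<ge> 1"
    and sample: "ds \<in> multisamples \<Delta> K"
  shows "\<exists>js. support_subsample X Xc F ds js \<and> length js = algorithm_A X Xc \<Phi> ds"
proof -
  define S where "S = {i \<in> active X Xc ds. \<Phi> ds i \<noteq> {}}"
  define js where "js = sorted_list_of_set S"
  define C' where "C' = feasible X Xc ds"
  define D where "D = feasible X Xc (map (\<lambda>j. ds ! j) js)"
  have act: "active X Xc ds \<subseteq> {..<length ds}" unfolding active_def by blast
  then have fin: "finite (active X Xc ds)" by (rule finite_subset) simp
  then have "finite S" unfolding S_def by simp
  then have js: "set js = S" "length js = card S" "sorted_wrt (<) js"
    unfolding js_def by simp_all
  have S_sub: "S \<subseteq> {..<length ds}" unfolding S_def using act by blast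
  have ds: "ds ! i \<in> \<Delta>" if "i < length ds" for i
    using sample that nth_mem unfolding multisamples_def by blast
  \<comment> \<open>If \<open>S\<close> is empty, this is the empty multisample, for which
    \<open>D\<close> is \<open>X\<close>; the assumption on feasible sets covers length 0 as
    well.\<close>
  then have js_sample: "map (\<lambda>j. ds ! j) js \<in> multisamples \<Delta> (length js)"
    using js(1) S_sub unfolding multisamples_def by auto
  have closed_Xc: "closed (Xc (ds ! i))" if "i < length ds" for i
  proof -
    have "closed {y. y \<le> b (ds ! i)}"
      unfolding less_eq_vec_def by (rule closed_interval_left_cart)
    then have "closed ((\<lambda>x. A (ds ! i) *v x) -` {y. y \<le> b (ds ! i)})"
      by (rule continuous_closed_vimage)
        (rule linear_continuous_at[OF matrix_vector_mul_bounded_linear])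
    then show ?thesis unfolding Xc_polyhedral[OF ds[OF that]] vimage_def by simp
  qed
  have D_eq: "D = (\<Inter>i\<in>S. Xc (ds ! i)) \<inter> X"
  proof -
    have "(\<Inter>i<length js. Xc (ds ! (js ! i))) = (\<Inter>j\<in>set js. Xc (ds ! j))"
      by (auto simp: set_conv_nth)
    then show ?thesis unfolding D_def feasible_def js(1)[symmetric] by simp
  qed
  have C'_eq: "C' = (\<Inter>i<length ds. Xc (ds ! i)) \<inter> X"
    unfolding C'_def feasible_def ..
  have C'_D: "C' \<subseteq> D" "D \<subseteq> X" using S_sub unfolding C'_eq D_eq by auto
  \<comment> \<open>The constraints dropped from the subsample hold throughout \<open>U\<close>,
    which is open as a finite intersection of interiors.\<close>
  define U where "U = (\<Inter>i\<in>{..<length ds} - S. interior (Xc (ds ! i)))"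
  have "open U" unfolding U_def by (intro open_INT) auto
  have C': "C' \<noteq> {}" "compact C'" "convex C'" and D: "compact D" "convex D"
    unfolding C'_def D_def using feasible_sets[OF sample] feasible_sets[OF js_sample] by simp_all
  have C'_closed: "closed C'"
    using C'(2) by (rule compact_imp_closed)
  have sol_U: "VI_solutions C' F \<subseteq> U"
  proof
    fix x assume x: "x \<in> VI_solutions C' F"
    then have xC: "x \<in> C'" unfolding VI_solutions_def by blast
    have "x \<in> interior (Xc (ds ! i))" if i: "i < length ds" "i \<notin> S" for i
    proof (rule ccontr)
      assume nint: "x \<notin> interior (Xc (ds ! i))"
      have "C' \<subseteq> Xc (ds ! i)" using i(1) unfolding C'_eq by blast
      \<comment> \<open>The inclusion passes to interiors, so \<open>x\<close> is not interior to
        \<open>C'\<close> either. Thus \<open>x\<close> lies on both frontiers and witnesses that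
        \<open>i\<close> is active.\<close>
      with nint xC have fr: "x \<in> frontier (Xc (ds ! i))" "x \<in> frontier C'"
        using closed_Xc[OF i(1)] C'_closed interior_mono[of C' "Xc (ds ! i)"]
        by (auto simp: frontier_def)
      then have active: "i \<in> active X Xc ds"
        using i(1) unfolding active_def C'_def by blast
      \<comment> \<open>The point \<open>x\<close> remains in the smaller set, and fewer points are
        left to test against.\<close>
      have "x \<in> VI_solutions (C' \<inter> frontier (Xc (ds ! i))) F"
        using x fr(1) unfolding VI_solutions_def by blast
      then have "\<Phi> ds i \<noteq> {}"
        using procedure[unfolded solution_procedure_def Let_def, rule_format, OF sample active]
        unfolding C'_def by auto
      with active i(2) show False unfolding S_def by blast
    qed
    then show "x \<in> U" unfolding U_def by blast
  qed
  \<comment> \<open>Counted constraints hold by membership in \<open>D\<close>, all others by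
    membership in \<open>U\<close>.\<close>
  have DU: "D \<inter> U \<subseteq> C'"
  proof
    fix x assume x: "x \<in> D \<inter> U"
    have "x \<in> Xc (ds ! i)" if "i < length ds" for i
    proof (cases "i \<in> S")
      case True
      then show ?thesis using x unfolding D_eq by blast
    next
      case False
      then have "x \<in> interior (Xc (ds ! i))" using x that unfolding U_def by blast
      then show ?thesis using interior_subset by (rule subsetD[rotated])
    qed
    then show "x \<in> C'" using x unfolding C'_eq D_eq by blast
  qed
  have "continuous_on D F"
    using F_continuous C'_D(2) by (rule continuous_on_subset)
  moreover have "pseudomonotone_on D F"
    using F_pseudomonotone C'_D(2) unfolding pseudomonotone_on_def by (meson subsetD)
  ultimately have "VI_solutions D F = VI_solutions C' F"
    using VI_solutions_eq_of_clopen[OF C'(2,3,1) compact_imp_closed[OF D(1)] D(2)]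
      \<open>open U\<close> sol_U DU C'_D(1) by simp
  then have "support_subsample X Xc F ds js"
    using js S_sub unfolding support_subsample_def Theta_def C'_def D_def by simp
  moreover have "length js = algorithm_A X Xc \<Phi> ds"
    unfolding algorithm_A_def fold_count_eq_card[OF fin] js(2) S_def ..
  ultimately show ?thesis by blast
qed

end
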